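(* Let $A, E\in\mathbb{C}^{n\times n}$ with $E$ invertible and Hermitian, and let $\mathrm{ind}(A)=k$ with $k\in\mathbb{N}$ (so $k\ge 1$). Then the $E$-weighted core-EP inverse $A^{\mathrm{ep},E}$ exists if and only if the $E$-weighted core inverse $(A^k)^{\mathrm{core},E}$ exists. Moreover, in that case, $A^{\mathrm{ep},E}=A^{k-1}(A^k)^{\mathrm{core},E}$ and $(A^k)^{\mathrm{core},E}=(A^{\mathrm{ep},E})^k$.
   Context: The index $\mathrm{ind}(A)$ is the smallest non-negative integer $k$ with $\mathrm{rank}(A^k)=\mathrm{rank}(A^{k+1})$ (with $A^0=I$). For $E$ invertible Hermitian: the $E$-weighted core inverse $B^{\mathrm{core},E}$ of a square matrix $B$ is the matrix $Y$, unique when it exists, with $YB^2=B$, $BY^2=Y$, $(EBY)^*=EBY$. With $k=\mathrm{ind}(A)$, the $E$-weighted core-EP inverse $A^{\mathrm{ep},E}$ of $A$ is the matrix $X\in\mathbb{C}^{n\times n}$, unique when it exists, with $XA^{k+1}=A^k$, $AX^2=X$, $(EAX)^*=EAX$. *)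

theory Defs
  imports
    "Jordan_Normal_Form.DL_Rank"
    "Jordan_Normal_Form.Schur_Decomposition"
begin

(* All notions below are meant for square matrices; the size is read off from dim_row. *)

definition mat_rank :: "complex mat \<Rightarrow> nat" where
  "mat_rank A = vec_space.rank (dim_row A) A"

definition mat_index :: "complex mat \<Rightarrow> nat" where
  "mat_index A = (LEAST k. mat_rank (A ^\<^sub>m k) = mat_rank (A ^\<^sub>m (k + 1)))"

definition hermitian_mat :: "complex mat \<Rightarrow> bool" where
  "hermitian_mat A \<longleftrightarrow> mat_adjoint A = A"

definition is_weighted_core_inverse :: "complex mat \<Rightarrow> complex mat \<Rightarrow> complex mat \<Rightarrow> bool" where
  "is_weighted_core_inverse E B Y \<longleftrightarrow>
     Y \<in> carrier_mat (dim_row B) (dim_row B) \<and>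
     Y * B ^\<^sub>m 2 = B \<and> B * Y ^\<^sub>m 2 = Y \<and> hermitian_mat (E * B * Y)"

definition is_weighted_core_EP_inverse :: "complex mat \<Rightarrow> complex mat \<Rightarrow> complex mat \<Rightarrow> bool" where
  "is_weighted_core_EP_inverse E A X \<longleftrightarrow>
     X \<in> carrier_mat (dim_row A) (dim_row A) \<and>
     X * A ^\<^sub>m (mat_index A + 1) = A ^\<^sub>m mat_index A \<and>
     A * X ^\<^sub>m 2 = X \<and> hermitian_mat (E * A * X)"

(* For E invertible and Hermitian the defining equations have at most one solution,
   so the following denote the inverses whenever these exist. *)

definition weighted_core_inverse :: "complex mat \<Rightarrow> complex mat \<Rightarrow> complex mat" where
  "weighted_core_inverse E B = (THE Y. is_weighted_core_inverse E B Y)"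

definition weighted_core_EP_inverse :: "complex mat \<Rightarrow> complex mat \<Rightarrow> complex mat" where
  "weighted_core_EP_inverse E A = (THE X. is_weighted_core_EP_inverse E A X)"

end

theory Submission
  imports Defs
begin

text \<open>
  Write \<open>B = A\<^sup>k\<close>. The two existence claims are pure monoid algebra: \<open>Y = X\<^sup>k\<close> and
  \<open>X = A\<^sup>k\<^sup>-\<^sup>1 Y\<close> satisfy \<open>BY = AX\<close>, so the Hermitian conditions coincide, and the only equation
  that is not immediate, \<open>A\<^sup>k\<^sup>-\<^sup>1 Y A\<^sup>k\<^sup>+\<^sup>1 = A\<^sup>k\<close>, follows from \<open>B = B Y B = B\<^sup>2 (Y\<^sup>2 B)\<close>.
  For uniqueness, two solutions give idempotents \<open>P = A X\<close> and \<open>Q = A X'\<close> with \<open>Q P = P\<close> and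
  \<open>P Q = Q\<close>; since \<open>E\<close>, \<open>E P\<close> and \<open>E Q\<close> are Hermitian,
  \<open>E P = Q\<^sup>* E P\<close> is the adjoint of \<open>E P Q = E Q\<close>, so \<open>P = Q\<close>, which determines the solution.
\<close>

section \<open>Monoid identities\<close>

context monoid
begin

lemma nat_pow_commute:
  assumes [simp]: "x \<in> carrier G"
  shows "x [^] (m::nat) \<otimes> x = x \<otimes> x [^] m"
  by (metis assms nat_pow_Suc nat_pow_Suc2)

lemma nat_pow_left_commute:
  assumes [simp]: "x \<in> carrier G" "z \<in> carrier G"
  shows "x [^] (m::nat) \<otimes> (x \<otimes> z) = x \<otimes> (x [^] m \<otimes> z)"
  by (simp add: nat_pow_commute flip: m_assoc)

text \<open>As rewrite rules these give products of one element and its powers a normal form: nested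
  to the right, with a single factor \<open>x\<close> moved in front of a power of
  \<open>x\<close>.\<close>

lemmas nat_pow_normalize = m_assoc nat_pow_commute nat_pow_left_commute

text \<open>At the junction of the two powers stands \<open>a \<otimes> (x \<otimes> x)\<close>,
  which collapses to \<open>x\<close>; each collapse lowers both exponents by one. Consequently
  \<open>x\<close> factors through every power of \<open>a\<close> on the left.\<close>

lemma pow_mult_pow_absorb:
  assumes [simp]: "a \<in> carrier G" "x \<in> carrier G" and "a \<otimes> (x \<otimes> x) = x"
  shows "a [^] (m::nat) \<otimes> x [^] Suc m = x"
proof (induction m)
  case (Suc m)
  have "a [^] Suc m \<otimes> x [^] Suc (Suc m) = a [^] m \<otimes> (a \<otimes> (x \<otimes> x)) \<otimes> x [^] m"
    by (simp add: nat_pow_normalize)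
  also have "\<dots> = a [^] m \<otimes> x [^] Suc m"
    using assms by (simp add: nat_pow_normalize)
  finally show ?case using Suc by simp
qed simp

lemma pow_Suc_mult_pow_Suc:
  assumes [simp]: "a \<in> carrier G" "x \<in> carrier G" and "a \<otimes> (x \<otimes> x) = x"
  shows "a [^] Suc m \<otimes> x [^] Suc m = a \<otimes> x"
proof -
  have "a [^] Suc m \<otimes> x [^] Suc m = a \<otimes> (a [^] m \<otimes> x [^] Suc m)"
    by (simp add: nat_pow_normalize)
  then show ?thesis by (simp only: pow_mult_pow_absorb[OF assms])
qed

text \<open>Here the junction contains \<open>x \<otimes> a [^] Suc k\<close>, so each
  \<open>x\<close> removes one \<open>a\<close> as long as \<open>k\<close> factors remain.\<close>

lemma pow_mult_pow_cancel:
  assumes [simp]: "a \<in> carrier G" "x \<in> carrier G" and "x \<otimes> a [^] Suc k = a [^] (k::nat)"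
  shows "x [^] (m::nat) \<otimes> a [^] (k + m) = a [^] k"
proof (induction m)
  case (Suc m)
  have "x [^] Suc m \<otimes> a [^] (k + Suc m) = x [^] m \<otimes> (x \<otimes> a [^] Suc k) \<otimes> a [^] m"
    using nat_pow_mult[of a "Suc k" m] by (simp add: nat_pow_normalize)
  also have "\<dots> = x [^] m \<otimes> a [^] (k + m)"
    using assms(3) by (simp add: m_assoc nat_pow_mult del: nat_pow_Suc)
  finally show ?case using Suc by simp
qed simp

lemma core_EP_proj_absorb:
  assumes [simp]: "a \<in> carrier G" "x \<in> carrier G" and 1: "x \<otimes> a [^] Suc k = a [^] (k::nat)"
    and 2: "a \<otimes> (x \<otimes> x) = x"
  shows "a \<otimes> x \<otimes> a [^] k = a [^] k"
proof -
  have "a \<otimes> x \<otimes> a [^] k = a \<otimes> x \<otimes> (x \<otimes> a [^] Suc k)" by (simp only: 1)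
  also have "\<dots> = (a \<otimes> (x \<otimes> x)) \<otimes> a [^] Suc k" by (simp add: m_assoc)
  finally show ?thesis using 1 2 by simp
qed

text \<open>The product \<open>a \<otimes> y\<close> has \<open>a [^] k\<close> as a left factor,
  and \<open>a \<otimes> x\<close> acts as a left identity on \<open>a [^] k\<close>. Using this in
  both directions relates the projections of two solutions.\<close>

lemma core_EP_proj_mult:
  assumes [simp]: "a \<in> carrier G" "x \<in> carrier G" "y \<in> carrier G"
    and "x \<otimes> a [^] Suc k = a [^] (k::nat)" "a \<otimes> (x \<otimes> x) = x" and y: "a \<otimes> (y \<otimes> y) = y"
  shows "a \<otimes> x \<otimes> (a \<otimes> y) = a \<otimes> y"
proof -
  have ay: "a \<otimes> y = a [^] k \<otimes> (a \<otimes> y [^] Suc k)"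
    using pow_Suc_mult_pow_Suc[OF _ _ y, of k] by (simp add: m_assoc)
  have "a \<otimes> x \<otimes> (a \<otimes> y) = (a \<otimes> x \<otimes> a [^] k) \<otimes> (a \<otimes> y [^] Suc k)"
    by (subst ay) (simp add: m_assoc)
  also have "\<dots> = a \<otimes> y"
    using core_EP_proj_absorb[OF assms(1,2,4,5)] ay by simp
  finally show ?thesis .
qed

lemma core_EP_determined_by_proj:
  assumes [simp]: "a \<in> carrier G" "x \<in> carrier G" "y \<in> carrier G"
    and x: "x \<otimes> a [^] Suc k = a [^] (k::nat)" "a \<otimes> (x \<otimes> x) = x"
    and y: "a \<otimes> (y \<otimes> y) = y" and eq: "a \<otimes> x = a \<otimes> y"
  shows "x = y"
proof -
  \<comment> \<open>Any such \<open>z\<close> equals \<open>a [^] k \<otimes> z [^] Suc k\<close>,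
    and \<open>x \<otimes> a\<close> fixes \<open>a [^] k\<close>. Applied to both \<open>x\<close>
    and \<open>y\<close>, this recovers each from its product with \<open>a\<close>.\<close>
  have absorb: "x \<otimes> a \<otimes> z = z" if [simp]: "z \<in> carrier G" and z: "a \<otimes> (z \<otimes> z) = z" for z
  proof -
    have "x \<otimes> a \<otimes> z = x \<otimes> a \<otimes> (a [^] k \<otimes> z [^] Suc k)"
      using pow_mult_pow_absorb[OF _ _ z, of k] by simp
    also have "\<dots> = x \<otimes> a [^] Suc k \<otimes> z [^] Suc k"
      by (simp add: nat_pow_normalize)
    finally show ?thesis
      using x(1) pow_mult_pow_absorb[OF _ _ z, of k] by simp
  qed
  have "x = x \<otimes> (a \<otimes> x)" using absorb[OF _ x(2)] by (simp add: m_assoc)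
  also have "\<dots> = x \<otimes> (a \<otimes> y)" by (simp only: eq)
  also have "\<dots> = y" using absorb[OF _ y] by (simp add: m_assoc)
  finally show ?thesis .
qed

text \<open>The third conclusion carries the Hermitian condition over; it also reduces the second to
  one collapse of \<open>a \<otimes> (x \<otimes> x)\<close>, where \<open>k \<ge> 1\<close>
  supplies the extra factor \<open>x\<close>.\<close>

lemma core_of_pow_if_core_EP:
  assumes [simp]: "a \<in> carrier G" "x \<in> carrier G"
    and x: "x \<otimes> a [^] Suc k = a [^] (k::nat)" "a \<otimes> (x \<otimes> x) = x" and k: "k \<ge> 1"
  shows "x [^] k \<otimes> (a [^] k \<otimes> a [^] k) = a [^] k"
    and "a [^] k \<otimes> (x [^] k \<otimes> x [^] k) = x [^] k"
    and "a [^] k \<otimes> x [^] k = a \<otimes> x"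
proof -
  obtain j where j: "k = Suc j" using k by (cases k) auto
  show "x [^] k \<otimes> (a [^] k \<otimes> a [^] k) = a [^] k"
    using pow_mult_pow_cancel[OF _ _ x(1), of k] by (simp add: nat_pow_mult)
  show ax: "a [^] k \<otimes> x [^] k = a \<otimes> x"
    unfolding j by (rule pow_Suc_mult_pow_Suc) (use x in simp_all)
  have "a [^] k \<otimes> (x [^] k \<otimes> x [^] k) = a \<otimes> x \<otimes> x [^] k"
    by (simp add: m_assoc[symmetric] ax)
  also have "\<dots> = a \<otimes> (x \<otimes> x) \<otimes> x [^] j"
    unfolding j by (simp add: nat_pow_normalize)
  also have "\<dots> = x [^] k"
    using x(2) unfolding j by (simp add: nat_pow_normalize)
  finally show "a [^] k \<otimes> (x [^] k \<otimes> x [^] k) = x [^] k" .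
qed

lemma core_EP_if_core_of_pow:
  assumes [simp]: "a \<in> carrier G" "y \<in> carrier G"
    and y: "y \<otimes> (a [^] k \<otimes> a [^] k) = a [^] (k::nat)" "a [^] k \<otimes> (y \<otimes> y) = y"
    and k: "k \<ge> 1"
  defines "x \<equiv> a [^] (k - 1) \<otimes> y"
  shows "x \<otimes> a [^] Suc k = a [^] k"
    and "a \<otimes> (x \<otimes> x) = x"
    and "a \<otimes> x = a [^] k \<otimes> y"
proof -
  obtain j where j: "k = Suc j" using k by (cases k) auto
  have x: "x = a [^] j \<otimes> y" by (simp add: x_def j)
  define b where "b = a [^] k"
  have [simp]: "b \<in> carrier G" "x \<in> carrier G" by (simp_all add: b_def x)
  have b: "a \<otimes> a [^] j = b" "a [^] j \<otimes> a = b"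
    by (simp_all add: b_def j nat_pow_commute)
  have comm: "a \<otimes> b = b \<otimes> a" "a [^] j \<otimes> b = b \<otimes> a [^] j"
    unfolding b_def by (metis assms(1) nat_pow_Suc nat_pow_Suc2)
      (simp add: nat_pow_mult add.commute)
  have comm': "a \<otimes> (b \<otimes> z) = b \<otimes> (a \<otimes> z)" if "z \<in> carrier G" for z
    using that comm(1) by (simp flip: m_assoc)
  have ybb: "y \<otimes> (b \<otimes> b) = b" and byy: "b \<otimes> (y \<otimes> y) = y"
    using y by (simp_all add: b_def)
  have byb: "b \<otimes> y \<otimes> b = b"
  proof -
    have "b \<otimes> y \<otimes> b = b \<otimes> (y \<otimes> y) \<otimes> (b \<otimes> b)"
      by (subst (2) ybb[symmetric]) (simp add: m_assoc)
    then show ?thesis using ybb byy by simp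
  qed
  show ax: "a \<otimes> x = a [^] k \<otimes> y"
    using b(1) by (simp add: x m_assoc[symmetric] b_def)
  \<comment> \<open>Inserting \<open>y = b \<otimes> (y \<otimes> y)\<close> and commuting
    \<open>b\<close> past \<open>a [^] j\<close> exposes a left factor \<open>b\<close> of
    \<open>x\<close>, on which \<open>b \<otimes> y\<close> acts as the identity.\<close>
  have x': "x = b \<otimes> (a [^] j \<otimes> (y \<otimes> y))"
  proof -
    have "x = a [^] j \<otimes> (b \<otimes> (y \<otimes> y))" by (simp add: byy x)
    also have "\<dots> = (a [^] j \<otimes> b) \<otimes> (y \<otimes> y)" by (simp add: m_assoc)
    finally show ?thesis by (simp add: comm m_assoc)
  qed
  have "a \<otimes> (x \<otimes> x) = b \<otimes> y \<otimes> x" using ax by (simp add: m_assoc[symmetric] b_def)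
  also have "\<dots> = (b \<otimes> y \<otimes> b) \<otimes> (a [^] j \<otimes> (y \<otimes> y))"
    by (subst x') (simp add: m_assoc)
  also have "\<dots> = x" by (simp add: byb x'[symmetric])
  finally show "a \<otimes> (x \<otimes> x) = x" .
  \<comment> \<open>In \<open>x \<otimes> a [^] Suc k\<close> the factor \<open>a\<close> separates
    \<open>y\<close> from a single \<open>b\<close>. Writing \<open>b\<close> as
    \<open>b \<otimes> (b \<otimes> w)\<close> and commuting \<open>a\<close> to the right lets
    \<open>y\<close> meet \<open>b \<otimes> b\<close>.\<close>
  define w where "w = y \<otimes> (y \<otimes> b)"
  have [simp]: "w \<in> carrier G" by (simp add: w_def)
  have w: "b \<otimes> (b \<otimes> w) = b"
  proof -
    have "b \<otimes> (b \<otimes> w) = b \<otimes> (b \<otimes> (y \<otimes> y) \<otimes> b)" by (simp add: w_def m_assoc)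
    then show ?thesis using byb byy by (simp add: m_assoc)
  qed
  have "x \<otimes> a [^] Suc k = a [^] j \<otimes> y \<otimes> (a \<otimes> (b \<otimes> (b \<otimes> w)))"
    by (simp only: w) (simp only: x b_def nat_pow_Suc2 assms(1))
  also have "\<dots> = a [^] j \<otimes> (y \<otimes> (b \<otimes> b)) \<otimes> (a \<otimes> w)" by (simp add: m_assoc comm')
  also have "\<dots> = b \<otimes> (a [^] j \<otimes> a) \<otimes> w" by (simp only: ybb comm(2)) (simp add: m_assoc)
  also have "\<dots> = b" using w by (simp add: b(2) m_assoc)
  finally show "x \<otimes> a [^] Suc k = a [^] k" by (simp add: b_def)
qed

end

section \<open>Adjoints\<close>

lemma mat_adjoint_carrier:
  "A \<in> carrier_mat n m \<Longrightarrow> mat_adjoint A \<in> carrier_mat m n"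
  by (auto simp: mat_adjoint_def)

lemma mat_adjoint_mult:
  fixes A B :: "complex mat"
  assumes "A \<in> carrier_mat n m" "B \<in> carrier_mat m p"
  shows "mat_adjoint (A * B) = mat_adjoint B * mat_adjoint A"
  using assms
  by (intro eq_matI)
    (auto simp: mat_adjoint_def mat_of_rows_def scalar_prod_def conjugate_complex_def mult.commute)

lemma hermitian_projections_eq:
  assumes C: "E \<in> carrier_mat n n" "P \<in> carrier_mat n n" "Q \<in> carrier_mat n n"
    and E: "invertible_mat E" "hermitian_mat E"
    and P: "hermitian_mat (E * P)" and Q: "hermitian_mat (E * Q)"
    and QP: "Q * P = P" and PQ: "P * Q = Q"
  shows "P = Q"
proof -
  \<comment> \<open>Insert \<open>R\<close> before \<open>S\<close>, then take the adjoint of the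
    Hermitian matrix \<open>E * R\<close>, where \<open>E\<close> is its own adjoint.\<close>
  have half: "E * S = mat_adjoint R * (E * S)"
    if "R \<in> carrier_mat n n" "S \<in> carrier_mat n n" "hermitian_mat (E * R)" "R * S = S" for R S
  proof -
    have "E * S = E * R * S" using that C by simp
    also have "E * R = mat_adjoint R * E"
      using that E(2) C mat_adjoint_mult[OF C(1) that(1)] by (simp add: hermitian_mat_def)
    finally show ?thesis using that C mat_adjoint_carrier[OF that(1)] by simp
  qed
  have "E * P = mat_adjoint Q * (E * P)" using half[of Q P] C Q QP by simp
  also have "\<dots> = mat_adjoint (mat_adjoint (E * P) * Q)"
  proof -
    have "mat_adjoint (E * P * Q) = mat_adjoint Q * mat_adjoint (E * P)"
      using C by (intro mat_adjoint_mult) auto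
    then show ?thesis using P by (simp add: hermitian_mat_def)
  qed
  also have "mat_adjoint (E * P) * Q = E * Q"
    using P C PQ by (simp add: hermitian_mat_def)
  finally have eq: "E * P = E * Q" using Q by (simp add: hermitian_mat_def)
  obtain F where "E * F = 1\<^sub>m n" and F: "F * E = 1\<^sub>m (dim_row F)"
    using E(1) C(1) by (auto simp: invertible_mat_def inverts_mat_def)
  \<comment> \<open>The two inverse equations fix the dimensions of \<open>F\<close>: its columns
    through \<open>E * F\<close>, its rows through \<open>F * E\<close>.\<close>
  have Fc: "F \<in> carrier_mat n n"
    using \<open>E * F = 1\<^sub>m n\<close> F C(1) by (metis carrier_matD(2) carrier_matI index_mult_mat(3) index_one_mat(3))
  have "F * (E * P) = F * (E * Q)" by (simp only: eq)
  then show ?thesis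
    using C Fc F by (simp flip: assoc_mult_mat[of _ n n _ n _ n])
qed

section \<open>Weighted core and core-EP inverses\<close>

lemma mat_pow_two:
  "(X :: 'a :: semiring_1 mat) \<in> carrier_mat n n \<Longrightarrow> X ^\<^sub>m 2 = X * X"
  by (simp add: numeral_2_eq_2)

text \<open>The exponent \<open>k\<close> is arbitrary rather than the index, so that one argument
  covers both kinds of inverse.\<close>

lemma weighted_core_EP_inverse_unique:
  assumes C: "A \<in> carrier_mat n n" "E \<in> carrier_mat n n" "X \<in> carrier_mat n n" "Y \<in> carrier_mat n n"
    and E: "invertible_mat E" "hermitian_mat E"
    and X: "X * A ^\<^sub>m Suc k = A ^\<^sub>m k" "A * X ^\<^sub>m 2 = X" "hermitian_mat (E * A * X)"
    and Y: "Y * A ^\<^sub>m Suc k = A ^\<^sub>m k" "A * Y ^\<^sub>m 2 = Y" "hermitian_mat (E * A * Y)"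
  shows "X = Y"
proof -
  \<comment> \<open>The \<open>n\<close> by \<open>n\<close> matrices form a ring, whose
    multiplicative monoid makes the identities above available for matrices.\<close>
  define R where "R = ring_mat TYPE(complex) n ()"
  interpret R: ring R unfolding R_def by (rule ring_mat)
  note R_simps = ring_mat_simps[of "TYPE(complex)" n "()", folded R_def]
  have pow: "A [^]\<^bsub>R\<^esub> (m::nat) = A ^\<^sub>m m" for m
    unfolding R_def by (rule pow_mat_ring_pow[OF C(1), symmetric])
  have X2: "A * (X * X) = X" and Y2: "A * (Y * Y) = Y"
    using X(2) Y(2) C by (simp_all add: mat_pow_two)
  have "A * X = A * Y"
  proof (rule hermitian_projections_eq[OF C(2)])
    show "A * Y * (A * X) = A * X" "A * X * (A * Y) = A * Y"
      using R.core_EP_proj_mult[of A Y X k] R.core_EP_proj_mult[of A X Y k] C X(1) Y(1) X2 Y2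
      by (simp_all only: R_simps pow)
  qed (use C E X(3) Y(3) in auto)
  then show ?thesis
    using R.core_EP_determined_by_proj[of A X Y k] C X(1) X2 Y2 by (simp only: R_simps pow)
qed

text \<open>The equations of the core inverse are those of the core-EP inverse with exponent
  1.\<close>

lemma is_weighted_core_inverse_unique:
  assumes "B \<in> carrier_mat n n" "E \<in> carrier_mat n n" "invertible_mat E" "hermitian_mat E"
    and "is_weighted_core_inverse E B X" "is_weighted_core_inverse E B Y"
  shows "X = Y"
  using assms weighted_core_EP_inverse_unique[of B n E X Y 1]
  by (auto simp: is_weighted_core_inverse_def numeral_2_eq_2)

lemma is_weighted_core_EP_inverse_unique:
  assumes "A \<in> carrier_mat n n" "E \<in> carrier_mat n n" "invertible_mat E" "hermitian_mat E"
    and "is_weighted_core_EP_inverse E A X" "is_weighted_core_EP_inverse E A Y"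
  shows "X = Y"
  using assms weighted_core_EP_inverse_unique[of A n E X Y "mat_index A"]
  by (auto simp: is_weighted_core_EP_inverse_def)

lemma is_weighted_core_inverse_pow:
  assumes C: "A \<in> carrier_mat n n" "E \<in> carrier_mat n n" and k: "mat_index A = k" "k \<ge> 1"
    and X: "is_weighted_core_EP_inverse E A X"
  shows "is_weighted_core_inverse E (A ^\<^sub>m k) (X ^\<^sub>m k)"
proof -
  define R where "R = ring_mat TYPE(complex) n ()"
  interpret R: ring R unfolding R_def by (rule ring_mat)
  note R_simps = ring_mat_simps[of "TYPE(complex)" n "()", folded R_def]
  have pow: "B [^]\<^bsub>R\<^esub> (m::nat) = B ^\<^sub>m m" if "B \<in> carrier_mat n n" for B m
    unfolding R_def by (rule pow_mat_ring_pow[OF that, symmetric])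
  have Xc: "X \<in> carrier_mat n n" and X1: "X * A ^\<^sub>m Suc k = A ^\<^sub>m k" and X2: "A * (X * X) = X"
    and XH: "hermitian_mat (E * A * X)"
    using X C k by (auto simp: is_weighted_core_EP_inverse_def mat_pow_two)
  note core = R.core_of_pow_if_core_EP[of A X k, unfolded R_simps pow[OF C(1)] pow[OF Xc],
      OF C(1) Xc X1 X2 k(2)]
  have "E * A ^\<^sub>m k * X ^\<^sub>m k = E * A * X"
    using C Xc core(3) by (simp add: assoc_mult_mat[of _ n n _ n _ n])
  then show ?thesis
    using C Xc XH core(1,2) by (simp add: is_weighted_core_inverse_def mat_pow_two[of _ n])
qed

lemma is_weighted_core_EP_inverse_pow_mult:
  assumes C: "A \<in> carrier_mat n n" "E \<in> carrier_mat n n" and k: "mat_index A = k" "k \<ge> 1"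
    and Y: "is_weighted_core_inverse E (A ^\<^sub>m k) Y"
  shows "is_weighted_core_EP_inverse E A (A ^\<^sub>m (k - 1) * Y)"
proof -
  define R where "R = ring_mat TYPE(complex) n ()"
  interpret R: ring R unfolding R_def by (rule ring_mat)
  note R_simps = ring_mat_simps[of "TYPE(complex)" n "()", folded R_def]
  have pow: "A [^]\<^bsub>R\<^esub> (m::nat) = A ^\<^sub>m m" for m
    unfolding R_def by (rule pow_mat_ring_pow[OF C(1), symmetric])
  have Yc: "Y \<in> carrier_mat n n" and Y1: "Y * (A ^\<^sub>m k * A ^\<^sub>m k) = A ^\<^sub>m k"
    and Y2: "A ^\<^sub>m k * (Y * Y) = Y" and YH: "hermitian_mat (E * A ^\<^sub>m k * Y)"
    using Y C by (auto simp: is_weighted_core_inverse_def mat_pow_two[of _ n])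
  note ep = R.core_EP_if_core_of_pow[of A Y k, unfolded R_simps pow, OF C(1) Yc Y1 Y2 k(2)]
  define X where "X = A ^\<^sub>m (k - 1) * Y"
  have Xc: "X \<in> carrier_mat n n" using C Yc by (auto simp: X_def)
  \<comment> \<open>Both inverses yield the same matrix after multiplication by \<open>E\<close>, so
    its being Hermitian transfers unchanged.\<close>
  have "E * A * X = E * A ^\<^sub>m k * Y"
    using C Yc Xc ep(3)[folded X_def] by (simp add: assoc_mult_mat[of _ n n _ n _ n])
  then have "is_weighted_core_EP_inverse E A X"
    using C Xc YH ep(1,2)[folded X_def] k
    by (simp add: is_weighted_core_EP_inverse_def mat_pow_two[OF Xc])
  then show ?thesis by (simp only: X_def)
qed

theorem theorem3p23:
  fixes A E :: "complex mat" and n k :: nat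
  assumes "A \<in> carrier_mat n n" and "E \<in> carrier_mat n n"
    and "invertible_mat E" and "hermitian_mat E"
    and "mat_index A = k" and "k \<ge> 1"
  shows "((\<exists>X. is_weighted_core_EP_inverse E A X) \<longleftrightarrow>
            (\<exists>Y. is_weighted_core_inverse E (A ^\<^sub>m k) Y)) \<and>
         ((\<exists>X. is_weighted_core_EP_inverse E A X) \<longrightarrow>
            weighted_core_EP_inverse E A
              = A ^\<^sub>m (k - 1) * weighted_core_inverse E (A ^\<^sub>m k) \<and>
            weighted_core_inverse E (A ^\<^sub>m k) = (weighted_core_EP_inverse E A) ^\<^sub>m k)"
proof (intro conjI impI)
  note to_core = is_weighted_core_inverse_pow[OF assms(1,2,5,6)]
  note to_EP = is_weighted_core_EP_inverse_pow_mult[OF assms(1,2,5,6)]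
  show "(\<exists>X. is_weighted_core_EP_inverse E A X) \<longleftrightarrow>
      (\<exists>Y. is_weighted_core_inverse E (A ^\<^sub>m k) Y)"
    using to_core to_EP by blast
  assume "\<exists>X. is_weighted_core_EP_inverse E A X"
  then obtain X where X: "is_weighted_core_EP_inverse E A X" ..
  \<comment> \<open>Stated for every \<open>Z\<close> because it is applied to \<open>X\<close> and
    to \<open>A ^\<^sub>m (k - 1) * X ^\<^sub>m k\<close>, obtained by passing to the core inverse
    and back.\<close>
  have EP: "weighted_core_EP_inverse E A = Z" if "is_weighted_core_EP_inverse E A Z" for Z
    unfolding weighted_core_EP_inverse_def
    using that is_weighted_core_EP_inverse_unique[OF assms(1-4)] by blast
  have core: "weighted_core_inverse E (A ^\<^sub>m k) = X ^\<^sub>m k"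
    unfolding weighted_core_inverse_def
    using to_core[OF X] is_weighted_core_inverse_unique[OF _ assms(2-4)] assms(1)
    by (meson pow_carrier_mat the_equality)
  show "weighted_core_EP_inverse E A = A ^\<^sub>m (k - 1) * weighted_core_inverse E (A ^\<^sub>m k)"
    using EP[OF to_EP[OF to_core[OF X]]] core by simp
  show "weighted_core_inverse E (A ^\<^sub>m k) = (weighted_core_EP_inverse E A) ^\<^sub>m k"
    using EP[OF X] core by simp
qed

end
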